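(* Let $P,Q$ be integers, $\Delta=P^2-4Q$, and let $n$ be an integer with $\gcd(n,2\Delta Q)=1$. Let $Q'$ be an integer with $Q'\equiv Q^{-1}\pmod n$. If $n$ is a strong Frobenius pseudoprime with respect to $X^2+(2-P^2Q')X+1$, then $n$ is a strong Lucas pseudoprime with parameters $(P,Q)$.
   Context: Lucas sequences: $U_0=0$, $U_1=1$, $U_k=PU_{k-1}-QU_{k-2}$; $V_0=2$, $V_1=P$, $V_k=PV_{k-1}-QV_{k-2}$. A strong Lucas pseudoprime with parameters $(P,Q)$ is a composite $n$ with $\gcd(n,2Q\Delta)=1$, written $n=2^rs+\left(\frac{\Delta}{n}\right)$ with $s$ odd (Jacobi symbol), such that either $U_s\equiv 0\pmod n$ or $V_{2^ts}\equiv 0\pmod n$ for some $t$ with $0\le t<r$. For monic polynomials $g_1,g_2$ over a commutative ring $R$ with identity, a monic $h\in R[x]$ is $\operatorname{gcmd}(g_1,g_2)$ if the ideal generated by $g_1,g_2$ equals the ideal generated by $h$ (it may fail to exist). Let $f(x)\in\mathbb{Z}[x]$ be monic of degree $d$ with discriminant $\Delta_f$. An odd integer $n>1$ is a Frobenius probable prime with respect to $f$ if $\gcd(n,f(0)\Delta_f)=1$ and, with all computations in $(\mathbb{Z}/n\mathbb{Z})[x]$: (Factorization) setting $f_0=f\bmod n$ and, for $1\le i\le d$, $F_i=\operatorname{gcmd}(x^{n^i}-x,f_{i-1})$ and $f_i=f_{i-1}/F_i$, all these gcmds exist and $f_d=1$; (Frobenius) for $2\le i\le d$, $F_i(x^n)\equiv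 0\pmod{F_i(x)}$; (Jacobi) with $S=\sum_{2\mid i}\deg(F_i)/i$, $(-1)^S=\left(\frac{\Delta_f}{n}\right)$. $n$ is a strong Frobenius probable prime with respect to $f$ if moreover (Square Root Step) for each $1\le i\le d$, writing $n^i-1=2^rs$ with $s$ odd, the polynomials $F_{i,0}=\operatorname{gcmd}(F_i,x^s-1)$ and $F_{i,j}=\operatorname{gcmd}(F_i,x^{2^{j-1}s}+1)$ ($1\le j\le r$) all exist, $F_i=\prod_{j=0}^rF_{i,j}$, and each $\deg F_{i,j}$ is a multiple of $i$. A strong Frobenius pseudoprime is a composite strong Frobenius probable prime. *)

theory Defs
  imports
    "HOL-Number_Theory.Residues"
    "HOL-Algebra.UnivPoly"
    "HOL-Algebra.Divisibility"
    "Subresultants.Resultant_Prelim"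
begin

section \<open>Lucas sequences and strong Lucas pseudoprimes\<close>

fun lucas_U :: "int \<Rightarrow> int \<Rightarrow> nat \<Rightarrow> int" where
  "lucas_U P Q 0 = 0"
| "lucas_U P Q (Suc 0) = 1"
| "lucas_U P Q (Suc (Suc k)) = P * lucas_U P Q (Suc k) - Q * lucas_U P Q k"

fun lucas_V :: "int \<Rightarrow> int \<Rightarrow> nat \<Rightarrow> int" where
  "lucas_V P Q 0 = 2"
| "lucas_V P Q (Suc 0) = P"
| "lucas_V P Q (Suc (Suc k)) = P * lucas_V P Q (Suc k) - Q * lucas_V P Q k"

text \<open>The Jacobi symbol; only meaningful for odd \<open>n > 0\<close>.\<close>

definition jacobi :: "int \<Rightarrow> int \<Rightarrow> int" where
  "jacobi a n = (\<Prod>p\<in>#prime_factorization n. Legendre a p)"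

definition composite :: "int \<Rightarrow> bool" where
  "composite n \<longleftrightarrow> n > 1 \<and> \<not> Factorial_Ring.prime n"

text \<open>For odd \<open>n > 1\<close> the decomposition \<open>n = 2\<^sup>r s + (\<Delta>/n)\<close> with \<open>s\<close> odd exists and is unique,
  so the existential quantifier over \<open>r\<close> and \<open>s\<close> only names them.\<close>

definition strong_lucas_pseudoprime :: "int \<Rightarrow> int \<Rightarrow> int \<Rightarrow> bool" where
  "strong_lucas_pseudoprime P Q n \<longleftrightarrow>
     (let \<Delta> = P^2 - 4 * Q in
      composite n \<and> gcd n (2 * Q * \<Delta>) = 1 \<and>
      (\<exists>r s :: nat. odd s \<and> n = 2 ^ r * int s + jacobi \<Delta> n \<and>
         ([lucas_U P Q s = 0] (mod n) \<or>
          (\<exists>t<r. [lucas_V P Q (2 ^ t * s) = 0] (mod n)))))"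


section \<open>Greatest common monic divisors\<close>

definition monic_UP :: "('a, 'm) ring_scheme \<Rightarrow> (nat \<Rightarrow> 'a) \<Rightarrow> bool" where
  "monic_UP R p \<longleftrightarrow> p \<in> carrier (UP R) \<and> up_ring.coeff (UP R) p (deg R p) = \<one>\<^bsub>R\<^esub>"

text \<open>A relation rather than a function, because a gcmd need not exist; it is unique if it does.\<close>

definition is_gcmd ::
  "('a, 'm) ring_scheme \<Rightarrow> (nat \<Rightarrow> 'a) \<Rightarrow> (nat \<Rightarrow> 'a) \<Rightarrow> (nat \<Rightarrow> 'a) \<Rightarrow> bool" where
  "is_gcmd R g1 g2 h \<longleftrightarrow>
     monic_UP R h \<and> Idl\<^bsub>UP R\<^esub> {g1, g2} = Idl\<^bsub>UP R\<^esub> {h}"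

abbreviation X_pow :: "('a, 'm) ring_scheme \<Rightarrow> nat \<Rightarrow> (nat \<Rightarrow> 'a)" where
  "X_pow R k \<equiv> up_ring.monom (UP R) \<one>\<^bsub>R\<^esub> k"

definition subst_X_pow :: "('a, 'm) ring_scheme \<Rightarrow> nat \<Rightarrow> (nat \<Rightarrow> 'a) \<Rightarrow> (nat \<Rightarrow> 'a)" where
  "subst_X_pow R k p = eval R (UP R) (\<lambda>a. up_ring.monom (UP R) a 0) (X_pow R k) p"


section \<open>Frobenius pseudoprimes\<close>

text \<open>Discriminant of a monic polynomial: \<open>(-1)\<^bsup>d(d-1)/2\<^esup> Res(f, f')\<close>.\<close>

definition discriminant :: "int poly \<Rightarrow> int" where
  "discriminant f = (-1) ^ (degree f * (degree f - 1) div 2) * resultant f (pderiv f)"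

definition reduce_poly :: "int \<Rightarrow> int poly \<Rightarrow> (nat \<Rightarrow> int)" where
  "reduce_poly n f = (\<lambda>k. Polynomial.coeff f k mod n)"

text \<open>In the factorization step, \<open>f\<^sub>i = f\<^sub>i\<^sub>-\<^sub>1 / F\<^sub>i\<close> is expressed by \<open>f\<^sub>i\<^sub>-\<^sub>1 = F\<^sub>i f\<^sub>i\<close>, which determines
  \<open>f\<^sub>i\<close> since \<open>F\<^sub>i\<close> is monic.\<close>

definition factorization_step :: "int \<Rightarrow> int poly \<Rightarrow> (nat \<Rightarrow> nat \<Rightarrow> int) \<Rightarrow> bool" where
  "factorization_step n f F \<longleftrightarrow>
     (let R = residue_ring n; d = degree f in
      \<exists>fs :: nat \<Rightarrow> nat \<Rightarrow> int.
        fs 0 = reduce_poly n f \<and>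
        (\<forall>i\<in>{1..d}.
           is_gcmd R (X_pow R (nat n ^ i) \<ominus>\<^bsub>UP R\<^esub> X_pow R 1) (fs (i - 1)) (F i) \<and>
           fs i \<in> carrier (UP R) \<and> fs (i - 1) = F i \<otimes>\<^bsub>UP R\<^esub> fs i) \<and>
        fs d = \<one>\<^bsub>UP R\<^esub>)"

definition frobenius_step :: "int \<Rightarrow> int poly \<Rightarrow> (nat \<Rightarrow> nat \<Rightarrow> int) \<Rightarrow> bool" where
  "frobenius_step n f F \<longleftrightarrow>
     (let R = residue_ring n in
      \<forall>i\<in>{2..degree f}. F i divides\<^bsub>UP R\<^esub> subst_X_pow R (nat n) (F i))"

text \<open>The sum \<open>S\<close> is formed in the rationals and required to be an integer, as \<open>(-1)\<^bsup>S\<^esup>\<close> presupposes.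
  (After the two previous steps \<open>i\<close> always divides \<open>deg F\<^sub>i\<close>.)\<close>

definition jacobi_step :: "int \<Rightarrow> int poly \<Rightarrow> (nat \<Rightarrow> nat \<Rightarrow> int) \<Rightarrow> bool" where
  "jacobi_step n f F \<longleftrightarrow>
     (\<exists>S :: nat.
        of_nat S = (\<Sum>i | i \<in> {1..degree f} \<and> even i.
                      of_nat (deg (residue_ring n) (F i)) / (of_nat i :: rat)) \<and>
        (-1) ^ S = jacobi (discriminant f) n)"

definition square_root_step :: "int \<Rightarrow> int poly \<Rightarrow> (nat \<Rightarrow> nat \<Rightarrow> int) \<Rightarrow> bool" where
  "square_root_step n f F \<longleftrightarrow>
     (let R = residue_ring n in
      \<forall>i\<in>{1..degree f}. \<exists>r s :: nat. odd s \<and> nat n ^ i - 1 = 2 ^ r * s \<and>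
        (\<exists>G :: nat \<Rightarrow> nat \<Rightarrow> int.
           is_gcmd R (F i) (X_pow R s \<ominus>\<^bsub>UP R\<^esub> \<one>\<^bsub>UP R\<^esub>) (G 0) \<and>
           (\<forall>j\<in>{1..r}. is_gcmd R (F i) (X_pow R (2 ^ (j - 1) * s) \<oplus>\<^bsub>UP R\<^esub> \<one>\<^bsub>UP R\<^esub>) (G j)) \<and>
           F i = (\<Otimes>\<^bsub>UP R\<^esub>j\<in>{0..r}. G j) \<and>
           (\<forall>j\<in>{0..r}. i dvd deg R (G j))))"

text \<open>The polynomials \<open>F\<^sub>1, \<dots>, F\<^sub>d\<close> are determined by the factorization step (gcmds are unique), so all
  steps below refer to the same \<open>F\<close>.\<close>

definition frobenius_steps :: "int \<Rightarrow> int poly \<Rightarrow> (nat \<Rightarrow> nat \<Rightarrow> int) \<Rightarrow> bool" where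
  "frobenius_steps n f F \<longleftrightarrow>
     factorization_step n f F \<and> frobenius_step n f F \<and> jacobi_step n f F"

definition frobenius_admissible :: "int \<Rightarrow> int poly \<Rightarrow> bool" where
  "frobenius_admissible n f \<longleftrightarrow>
     lead_coeff f = 1 \<and> odd n \<and> n > 1 \<and> gcd n (poly f 0 * discriminant f) = 1"

definition frobenius_probable_prime :: "int \<Rightarrow> int poly \<Rightarrow> bool" where
  "frobenius_probable_prime n f \<longleftrightarrow>
     frobenius_admissible n f \<and> (\<exists>F. frobenius_steps n f F)"

definition strong_frobenius_probable_prime :: "int \<Rightarrow> int poly \<Rightarrow> bool" where
  "strong_frobenius_probable_prime n f \<longleftrightarrow>
     frobenius_admissible n f \<and> (\<exists>F. frobenius_steps n f F \<and> square_root_step n f F)"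

lemma strong_frobenius_probable_prime_imp:
  "strong_frobenius_probable_prime n f \<Longrightarrow> frobenius_probable_prime n f"
  unfolding strong_frobenius_probable_prime_def frobenius_probable_prime_def by blast

definition strong_frobenius_pseudoprime :: "int \<Rightarrow> int poly \<Rightarrow> bool" where
  "strong_frobenius_pseudoprime n f \<longleftrightarrow> composite n \<and> strong_frobenius_probable_prime n f"

end

theory Submission
  imports Defs
begin

text \<open>
  Put \<open>b = 2 - P\<^sup>2 Q'\<close>. If \<open>\<alpha>\<close>, \<open>\<beta>\<close> are the roots of \<open>X\<^sup>2 - P X + Q\<close>, then modulo \<open>n\<close> the polynomial
  \<open>f = X\<^sup>2 + b X + 1\<close> has the roots \<open>\<alpha> / \<beta>\<close> and \<open>\<beta> / \<alpha>\<close>, and its discriminant is \<open>\<Delta>\<close> times a unit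
  square. Hence \<open>X\<^sup>m = 1\<close> modulo \<open>(n, f)\<close> gives \<open>\<alpha>\<^sup>m = \<beta>\<^sup>m\<close>, that is \<open>U\<^sub>m = 0\<close>, and \<open>X\<^sup>m = -1\<close> gives
  \<open>\<alpha>\<^sup>m + \<beta>\<^sup>m = V\<^sub>m = 0\<close>. Since the discriminant of \<open>f\<close> is a unit, the square root step for the \<open>F\<^sub>i\<close> equal
  to \<open>f\<close> yields such a congruence for \<open>X\<close>, even if \<open>f\<close> splits there into two linear factors.
  The Jacobi step decides which \<open>F\<^sub>i\<close> this is. If \<open>(\<Delta>/n) = 1\<close>, it is \<open>F\<^sub>1\<close> and the exponents are the required
  ones. If \<open>(\<Delta>/n) = -1\<close>, it is \<open>F\<^sub>2\<close>; then \<open>X\<^sup>n - X\<close> is a unit modulo \<open>(n, f)\<close>, so that the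
  Frobenius step forces \<open>X\<^sup>n\<close> to be the other root \<open>1 / X\<close>. From \<open>X\<^bsup>n+1\<^esup> = 1\<close>, the odd part of
  \<open>n\<^sup>2 - 1\<close> in the exponents can be replaced by the odd part of \<open>n + 1\<close>.
\<close>

section \<open>Congruences modulo an ideal with two generators\<close>

text \<open>Equality in the quotient by the ideal \<open>(a, b)\<close>. With
  \<open>a = [:n:]\<close> and \<open>b\<close> monic this is arithmetic in
  \<open>(Z/n)[X]/(b)\<close>, carried out on integer polynomials.\<close>

definition ideal_cong :: "'a::comm_ring_1 \<Rightarrow> 'a \<Rightarrow> 'a \<Rightarrow> 'a \<Rightarrow> bool" where
  "ideal_cong a b x y \<longleftrightarrow> (\<exists>u v. x - y = a * u + b * v)"

lemma ideal_congI: "x - y = a * u + b * v \<Longrightarrow> ideal_cong a b x y"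
  unfolding ideal_cong_def by blast

lemma ideal_cong_refl [simp]: "ideal_cong a b x x"
  by (rule ideal_congI[of _ _ _ 0 _ 0]) simp

lemma ideal_cong_sym: "ideal_cong a b x y \<Longrightarrow> ideal_cong a b y x"
  unfolding ideal_cong_def by (metis minus_diff_eq minus_add_distrib mult_minus_right uminus_add_conv_diff)

lemma ideal_cong_add:
  assumes "ideal_cong a b x y" "ideal_cong a b x' y'"
  shows "ideal_cong a b (x + x') (y + y')"
proof -
  from assms obtain u v u' v' where "x - y = a * u + b * v" "x' - y' = a * u' + b * v'"
    unfolding ideal_cong_def by blast
  then have "(x + x') - (y + y') = a * (u + u') + b * (v + v')"
    by (simp add: algebra_simps)
  then show ?thesis by (rule ideal_congI)
qed

lemma ideal_cong_mult_left:
  assumes "ideal_cong a b x y"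
  shows "ideal_cong a b (z * x) (z * y)"
proof -
  from assms obtain u v where "x - y = a * u + b * v"
    unfolding ideal_cong_def by blast
  then have "z * (x - y) = z * (a * u + b * v)" by simp
  then have "z * x - z * y = a * (z * u) + b * (z * v)" by (simp add: algebra_simps)
  then show ?thesis by (rule ideal_congI)
qed

lemma ideal_cong_mult_right: "ideal_cong a b x y \<Longrightarrow> ideal_cong a b (x * z) (y * z)"
  using ideal_cong_mult_left[of a b x y z] by (simp add: mult.commute)

lemma ideal_cong_minus: "ideal_cong a b x y \<Longrightarrow> ideal_cong a b (- x) (- y)"
  using ideal_cong_mult_left[of a b x y "-1"] by simp

lemma ideal_cong_diff:
  "ideal_cong a b x y \<Longrightarrow> ideal_cong a b x' y' \<Longrightarrow> ideal_cong a b (x - x') (y - y')"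
  using ideal_cong_add[of a b x y "- x'" "- y'"] ideal_cong_minus[of a b x' y'] by simp

lemma ideal_cong_trans [trans]:
  "ideal_cong a b x y \<Longrightarrow> ideal_cong a b y z \<Longrightarrow> ideal_cong a b x z"
  using ideal_cong_add[of a b x y y z] unfolding ideal_cong_def by simp

lemma ideal_cong_mult:
  "ideal_cong a b x y \<Longrightarrow> ideal_cong a b x' y' \<Longrightarrow> ideal_cong a b (x * x') (y * y')"
  by (meson ideal_cong_mult_left ideal_cong_mult_right ideal_cong_trans)

lemma ideal_cong_power: "ideal_cong a b x y \<Longrightarrow> ideal_cong a b (x ^ k) (y ^ k)"
  by (induction k) (auto intro: ideal_cong_mult)

lemma ideal_cong_const:
  fixes a :: int
  assumes "[x = y] (mod a)"
  shows "ideal_cong [:a:] m [:x:] [:y:]"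
proof -
  from assms obtain k where "x - y = a * k" by (metis cong_iff_dvd_diff dvdE)
  then show ?thesis by (intro ideal_congI[of _ _ _ "[:k:]" _ 0]) (simp add: mult.commute)
qed

text \<open>\<open>Z/n\<close> embeds into \<open>(Z/n)[X]/(m)\<close>: a multiple of
  \<open>m\<close> that is constant modulo \<open>n\<close> vanishes modulo \<open>n\<close>. This
  brings polynomial congruences back to integers.\<close>

lemma ideal_cong_const_imp_cong:
  fixes n x y :: int
  assumes cong: "ideal_cong [:n:] m [:x:] [:y:]"
    and monic: "lead_coeff m = 1" and deg: "degree m > 0"
  shows "[x = y] (mod n)"
proof -
  from cong obtain u v where uv: "[:x:] - [:y:] = [:n:] * u + m * v"
    unfolding ideal_cong_def by blast
  have mv: "n dvd Polynomial.coeff (m * v) k" if "k > 0" for k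
  proof -
    have "Polynomial.coeff ([:x:] - [:y:]) k = n * Polynomial.coeff u k + Polynomial.coeff (m * v) k"
      unfolding uv by simp
    moreover have "Polynomial.coeff ([:x:] - [:y:]) k = 0"
      using that by (cases k) auto
    ultimately show ?thesis
      by (metis add.commute dvd_0_right dvd_add_times_triv_right_iff mult.commute)
  qed
  define d where "d = degree m"
  \<comment> \<open>Downward induction on \<open>k\<close>: as \<open>m\<close> is monic,
    coefficient \<open>d + k\<close> of \<open>m * v\<close> is that of \<open>v\<close> at
    \<open>k\<close> plus multiples of higher coefficients of \<open>v\<close>, and
    \<open>d + k > 0\<close> allows \<open>mv\<close>.\<close>
  have v: "n dvd Polynomial.coeff v k" for k
  proof (induction "degree v - k" arbitrary: k rule: less_induct)
    case less
    show ?case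
    proof (cases "k > degree v")
      case True
      then show ?thesis by (simp add: coeff_eq_0)
    next
      case False
      have "Polynomial.coeff (m * v) (d + k)
          = (\<Sum>i\<le>d + k. Polynomial.coeff m i * Polynomial.coeff v (d + k - i))"
        by (rule coeff_mult)
      also have "\<dots> = (\<Sum>i\<le>d. Polynomial.coeff m i * Polynomial.coeff v (d + k - i))"
        by (rule sum.mono_neutral_right) (auto simp: d_def coeff_eq_0)
      also have "\<dots> = (\<Sum>i<d. Polynomial.coeff m i * Polynomial.coeff v (d + k - i))
          + Polynomial.coeff v k"
        using monic by (simp add: d_def lessThan_Suc_atMost[symmetric])
      finally have eq: "Polynomial.coeff (m * v) (d + k)
          = (\<Sum>i<d. Polynomial.coeff m i * Polynomial.coeff v (d + k - i)) + Polynomial.coeff v k" .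
      have "n dvd Polynomial.coeff v (d + k - i)" if "i < d" for i
      proof (cases "d + k - i > degree v")
        case True
        then show ?thesis by (simp add: coeff_eq_0)
      next
        case F: False
        show ?thesis by (rule less) (use that F in auto)
      qed
      then have "n dvd (\<Sum>i<d. Polynomial.coeff m i * Polynomial.coeff v (d + k - i))"
        by (intro dvd_sum dvd_mult) auto
      moreover have "n dvd Polynomial.coeff (m * v) (d + k)"
        using deg by (intro mv) (simp add: d_def)
      ultimately show ?thesis unfolding eq by (simp add: dvd_add_right_iff)
    qed
  qed
  have "x - y = Polynomial.coeff ([:x:] - [:y:]) 0" by simp
  also have "\<dots> = n * Polynomial.coeff u 0 + Polynomial.coeff m 0 * Polynomial.coeff v 0"
    unfolding uv by (simp add: coeff_mult)
  finally show ?thesis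
    using v[of 0] by (simp add: cong_iff_dvd_diff)
qed

section \<open>Cancellation, change of modulus, and elements of two-power order\<close>

lemma ideal_cong_diff_0_iff: "ideal_cong a b (x - y) 0 \<longleftrightarrow> ideal_cong a b x y"
  by (simp add: ideal_cong_def)

lemma ideal_cong_cancel_unit:
  assumes "ideal_cong a b (z * w) 1" "ideal_cong a b (z * x) (z * y)"
  shows "ideal_cong a b x y"
proof -
  have "x = 1 * x" by simp
  also have "ideal_cong a b \<dots> (z * w * x)"
    by (intro ideal_cong_mult_right ideal_cong_sym[OF assms(1)])
  also have "\<dots> = w * (z * x)" by (simp add: mult_ac)
  also have "ideal_cong a b \<dots> (w * (z * y))" by (rule ideal_cong_mult_left[OF assms(2)])
  also have "\<dots> = z * w * y" by (simp add: mult_ac)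
  also have "ideal_cong a b \<dots> (1 * y)" by (rule ideal_cong_mult_right[OF assms(1)])
  finally show ?thesis by simp
qed

text \<open>\<open>b\<close> lies in the ideal \<open>(a, b')\<close>. With
  \<open>a = [:n:]\<close>, the second modulus matters only through its reduction modulo
  \<open>n\<close>.\<close>

lemma ideal_cong_change_modulus:
  assumes "a dvd b - b'" "ideal_cong a b x y"
  shows "ideal_cong a b' x y"
proof -
  from assms obtain w u v where "b - b' = a * w" "x - y = a * u + b * v"
    by (auto simp: ideal_cong_def elim: dvdE)
  then have "x - y = a * (u + w * v) + b' * v" by (simp add: algebra_simps)
  then show ?thesis by (rule ideal_congI)
qed

text \<open>An odd \<open>k\<close> has an inverse \<open>x\<close> modulo \<open>2 ^ r\<close>, and
  exponents of \<open>y\<close> count only modulo \<open>2 ^ r\<close>; hence \<open>y\<close> is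
  \<open>(y ^ k) ^ x\<close>.\<close>

lemma ideal_cong_odd_power:
  assumes y: "ideal_cong a b (y ^ 2 ^ r) 1" and yk: "ideal_cong a b (y ^ k) e"
    and k: "odd k" and r: "r > 0" and e: "e = 1 \<or> e = -1"
  shows "ideal_cong a b y e"
proof -
  obtain x where x: "[k * x = 1] (mod 2 ^ r)"
    using cong_solve_coprime_nat[of k "2 ^ r"] k by auto
  have "(1::nat) < 2 ^ r" using r by (intro one_less_power) simp_all
  then have "k * x mod 2 ^ r = 1" using x r by (simp add: cong_def)
  then have kx: "k * x = 2 ^ r * (k * x div 2 ^ r) + 1"
    by (metis mult_div_mod_eq)
  \<comment> \<open>Since \<open>r > 0\<close>, \<open>k * x\<close> is odd; so \<open>x\<close> is
    odd and the sign \<open>e\<close> survives.\<close>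
  then have "odd (k * x)" using r by (metis dvd_mult2 dvd_power even_plus_one_iff)
  then have ex: "e ^ x = e" using e by (auto simp: uminus_power_if)
  have "y = 1 ^ (k * x div 2 ^ r) * y" by simp
  also have "ideal_cong a b \<dots> ((y ^ 2 ^ r) ^ (k * x div 2 ^ r) * y)"
    by (intro ideal_cong_mult_right ideal_cong_power ideal_cong_sym[OF y])
  also have "\<dots> = y ^ (2 ^ r * (k * x div 2 ^ r) + 1)"
    by (simp only: power_add power_mult power_one_right)
  also have "\<dots> = (y ^ k) ^ x" by (simp only: kx[symmetric] power_mult)
  also have "ideal_cong a b \<dots> (e ^ x)" by (rule ideal_cong_power[OF yk])
  finally show ?thesis by (simp only: ex)
qed

text \<open>If \<open>i\<close> were at least \<open>r\<close>, the exponent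
  \<open>2 ^ i * k\<close> would be a multiple of \<open>2 ^ r\<close>, forcing 1 = -1. So
  \<open>i < r\<close>, and the odd factor \<open>k\<close> is removed from the power of
  \<open>y ^ 2 ^ i\<close>.\<close>

lemma ideal_cong_two_power_order:
  assumes nontrivial: "\<not> ideal_cong a b 1 (-1)"
    and y: "ideal_cong a b (y ^ 2 ^ r) 1" and yk: "ideal_cong a b (y ^ (2 ^ i * k)) (-1)" and k: "odd k"
  shows "i < r" "ideal_cong a b (y ^ 2 ^ i) (-1)"
proof -
  show ir: "i < r"
  proof (rule ccontr)
    assume "\<not> i < r"
    then have eq: "(2::nat) ^ i * k = 2 ^ r * (2 ^ (i - r) * k)" by (simp flip: power_add)
    have "ideal_cong a b (y ^ (2 ^ i * k)) 1"
      using ideal_cong_power[OF y, of "2 ^ (i - r) * k"] by (simp only: eq power_mult power_one)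
    then show False
      using nontrivial yk ideal_cong_sym ideal_cong_trans by blast
  qed
  show "ideal_cong a b (y ^ 2 ^ i) (-1)"
  proof (rule ideal_cong_odd_power)
    have "(2::nat) ^ i * 2 ^ (r - i) = 2 ^ r" using ir by (simp flip: power_add)
    then show "ideal_cong a b ((y ^ 2 ^ i) ^ 2 ^ (r - i)) 1"
      using y by (simp flip: power_mult)
    show "ideal_cong a b ((y ^ 2 ^ i) ^ k) (-1)" using yk by (simp add: power_mult)
  qed (use k ir in auto)
qed

section \<open>Lucas sequences\<close>

context
  fixes P Q n :: int
begin

abbreviation quadratic_cong :: "int poly \<Rightarrow> int poly \<Rightarrow> bool" (infix "\<equiv>\<^sub>M" 50) where
  "x \<equiv>\<^sub>M y \<equiv> ideal_cong [:n:] [:Q, -P, 1:] x y"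

text \<open>The roots of \<open>X^2 - P X + Q\<close> are represented by the variable and its
  conjugate \<open>P - X\<close>, so no extension ring has to be built.\<close>

private definition \<alpha> :: "int poly" where "\<alpha> = [:0, 1:]"
private definition \<beta> :: "int poly" where "\<beta> = [:P, -1:]"

private lemma AB: "\<alpha> * \<beta> \<equiv>\<^sub>M [:Q:]"
  by (rule ideal_congI[of _ _ _ 0 _ "-1"]) (simp add: \<alpha>_def \<beta>_def)

private lemma AA: "\<alpha> * \<alpha> \<equiv>\<^sub>M [:P:] * \<alpha> - [:Q:]"
  by (rule ideal_congI[of _ _ _ 0 _ 1]) (simp add: \<alpha>_def)

private lemma BB: "\<beta> * \<beta> \<equiv>\<^sub>M [:P:] * \<beta> - [:Q:]"
  by (rule ideal_congI[of _ _ _ 0 _ 1]) (simp add: \<beta>_def)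

private lemma AmB: "(\<alpha> - \<beta>) * (\<alpha> - \<beta>) \<equiv>\<^sub>M [:P\<^sup>2 - 4 * Q:]"
  by (rule ideal_congI[of _ _ _ 0 _ "[:4:]"]) (simp add: \<alpha>_def \<beta>_def power2_eq_square)

section \<open>Binet formulas for both Lucas sequences\<close>

private lemma power_rec:
  assumes "Z * Z \<equiv>\<^sub>M [:P:] * Z - [:Q:]"
  shows "Z ^ Suc (Suc k) \<equiv>\<^sub>M [:P:] * Z ^ Suc k - [:Q:] * Z ^ k"
  using ideal_cong_mult_left[OF assms, of "Z ^ k"] by (simp add: algebra_simps)

text \<open>Binet's formula with the denominator cleared, as \<alpha> - \<beta> may fail to be
  invertible here. Both sides satisfy the same recurrence.\<close>

private lemma lucas_U_AB: "[:lucas_U P Q k:] * (\<alpha> - \<beta>) \<equiv>\<^sub>M \<alpha> ^ k - \<beta> ^ k"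
proof (induction k rule: less_induct)
  case (less k)
  consider "k = 0" | "k = 1" | j where "k = Suc (Suc j)"
    by (metis One_nat_def not0_implies_Suc)
  then show ?case
  proof cases
    case 3
    have "[:lucas_U P Q k:] * (\<alpha> - \<beta>) = [:P:] * ([:lucas_U P Q (Suc j):] * (\<alpha> - \<beta>)) - [:Q:] * ([:lucas_U P Q j:] * (\<alpha> - \<beta>))"
      unfolding 3 by (simp add: \<alpha>_def \<beta>_def algebra_simps)
    also have "\<dots> \<equiv>\<^sub>M [:P:] * (\<alpha> ^ Suc j - \<beta> ^ Suc j) - [:Q:] * (\<alpha> ^ j - \<beta> ^ j)"
      by (intro ideal_cong_diff ideal_cong_mult_left less) (simp_all add: 3)
    also have "\<dots> = ([:P:] * \<alpha> ^ Suc j - [:Q:] * \<alpha> ^ j) - ([:P:] * \<beta> ^ Suc j - [:Q:] * \<beta> ^ j)"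
      by (simp only: right_diff_distrib)
    also have "\<dots> \<equiv>\<^sub>M \<alpha> ^ k - \<beta> ^ k"
      unfolding 3 by (intro ideal_cong_diff ideal_cong_sym[OF power_rec] AA BB)
    finally show ?thesis .
  qed simp_all
qed

private lemma lucas_V_AB: "[:lucas_V P Q k:] \<equiv>\<^sub>M \<alpha> ^ k + \<beta> ^ k"
proof (induction k rule: less_induct)
  case (less k)
  consider "k = 0" | "k = 1" | j where "k = Suc (Suc j)"
    by (metis One_nat_def not0_implies_Suc)
  then show ?case
  proof cases
    case 3
    have "[:lucas_V P Q k:] = [:P:] * [:lucas_V P Q (Suc j):] - [:Q:] * [:lucas_V P Q j:]"
      unfolding 3 by simp
    also have "\<dots> \<equiv>\<^sub>M [:P:] * (\<alpha> ^ Suc j + \<beta> ^ Suc j) - [:Q:] * (\<alpha> ^ j + \<beta> ^ j)"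
      by (intro ideal_cong_diff ideal_cong_mult_left less) (simp_all add: 3)
    also have "\<dots> = ([:P:] * \<alpha> ^ Suc j - [:Q:] * \<alpha> ^ j) + ([:P:] * \<beta> ^ Suc j - [:Q:] * \<beta> ^ j)"
      by (simp only: distrib_left)
    also have "\<dots> \<equiv>\<^sub>M \<alpha> ^ k + \<beta> ^ k"
      unfolding 3 by (intro ideal_cong_add ideal_cong_sym[OF power_rec] AA BB)
    finally show ?thesis .
  next
    case 1 then show ?thesis by (simp add: one_pCons)
  next
    case 2 then show ?thesis by (simp add: \<alpha>_def \<beta>_def)
  qed
qed

text \<open>The substitution \<open>W = Q' X\<^sup>2\<close> below comes from \<open>\<alpha> / \<beta> = \<alpha>\<^sup>2 / (\<alpha> \<beta>) = Q' \<alpha>\<^sup>2\<close>.\<close>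

private lemma root_power_cong:
  fixes Q' :: int and e :: int
  assumes Q': "[Q' * Q = 1] (mod n)"
    and cong: "ideal_cong [:n:] [:1, 2 - P\<^sup>2 * Q', 1:] ([:0, 1:] ^ m) [:e:]"
  shows "\<alpha> ^ m \<equiv>\<^sub>M [:e:] * \<beta> ^ m"
proof -
  from cong obtain u v where uv: "[:0, 1:] ^ m - [:e:] = [:n:] * u + [:1, 2 - P\<^sup>2 * Q', 1:] * v"
    unfolding ideal_cong_def by blast
  define W where "W = [:0, 0, Q':]"
  from Q' obtain t where t: "Q' * Q = 1 + n * t" by (metis cong_iff_lin cong_sym)
  \<comment> \<open>The second cofactor is \<open>Q'^2 (X^2 + P X + Q)\<close>, because
    \<open>(X^2 - P X + Q)(X^2 + P X + Q) = X^4 + (2 Q - P^2) X^2 + Q^2\<close>. The first one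
    collects the errors from replacing \<open>Q' * Q\<close> by 1.\<close>
  have W2: "pcompose [:1, 2 - P\<^sup>2 * Q', 1:] W =
     [:n:] * [: -(t * (2 + n * t)), 0, -(2 * Q' * t) :] + [:Q, -P, 1:] * [:Q' * Q' * Q, Q' * Q' * P, Q' * Q':]"
  proof -
    have "Q' * Q * (Q' * Q) = 1 + n * (t * (2 + n * t))"
      unfolding t by (simp add: algebra_simps)
    moreover have "Q' * (Q' * Q) = Q' + n * (t * Q')"
      unfolding t by (simp add: algebra_simps)
    ultimately show ?thesis
      by (simp add: W_def pcompose_pCons power2_eq_square algebra_simps)
  qed
  \<comment> \<open>Substituting \<open>W\<close> for \<open>X\<close> carries the given congruence
    over to the modulus \<open>X^2 - P X + Q\<close>.\<close>
  have "W ^ m - [:e:] = pcompose ([:0, 1:] ^ m - [:e:]) W"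
    by (simp add: pcompose_diff pcompose_hom.hom_power pcompose_pCons)
  also have "\<dots> = [:n:] * (pcompose u W + [: -(t * (2 + n * t)), 0, -(2 * Q' * t) :] * pcompose v W)
      + [:Q, -P, 1:] * ([:Q' * Q' * Q, Q' * Q' * P, Q' * Q':] * pcompose v W)"
    unfolding uv pcompose_add pcompose_mult W2 pcompose_const
    by (simp only: distrib_left distrib_right mult.assoc add.assoc)
  finally have Wm: "W ^ m \<equiv>\<^sub>M [:e:]" by (rule ideal_congI)
  have W: "W = [:Q':] * (\<alpha> * \<alpha>)" by (simp add: W_def \<alpha>_def)
  have QQ: "[:Q':] * [:Q:] \<equiv>\<^sub>M 1"
    using ideal_cong_const[OF Q', of "[:Q, -P, 1:]"] by (simp add: one_pCons mult.commute)
  \<comment> \<open>Multiplying by this power of \<open>Q'\<close> \<alpha> \<beta>, which is 1,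
    replaces the division by \<beta>.\<close>
  have unit: "([:Q':] * (\<alpha> * \<beta>)) ^ m \<equiv>\<^sub>M 1"
    using ideal_cong_power[OF ideal_cong_trans[OF ideal_cong_mult_left[OF AB] QQ], of m] by simp
  have "\<alpha> ^ m = 1 * \<alpha> ^ m" by simp
  also have "\<dots> \<equiv>\<^sub>M ([:Q':] * (\<alpha> * \<beta>)) ^ m * \<alpha> ^ m"
    by (intro ideal_cong_mult_right ideal_cong_sym[OF unit])
  also have "\<dots> = \<beta> ^ m * W ^ m"
    unfolding W by (simp only: power_mult_distrib[symmetric]) (simp add: mult_ac)
  also have "\<dots> \<equiv>\<^sub>M \<beta> ^ m * [:e:]" by (rule ideal_cong_mult_left[OF Wm])
  finally show ?thesis by (simp add: mult.commute)
qed

text \<open>A second factor \<alpha> - \<beta> turns the denominator of Binet's formula into the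
  integer \<open>P^2 - 4 Q\<close>, which is cancelled after descending to
  \<open>Z/n\<close>.\<close>

lemma lucas_U_cong_0:
  fixes Q' :: int
  assumes "[Q' * Q = 1] (mod n)" and "coprime n (P\<^sup>2 - 4 * Q)"
    and "ideal_cong [:n:] [:1, 2 - P\<^sup>2 * Q', 1:] ([:0, 1:] ^ m) 1"
  shows "[lucas_U P Q m = 0] (mod n)"
proof -
  have eq: "\<alpha> ^ m \<equiv>\<^sub>M \<beta> ^ m"
    using root_power_cong[of Q' m 1] assms by (simp add: one_pCons)
  have "[:lucas_U P Q m * (P\<^sup>2 - 4 * Q):] = [:lucas_U P Q m:] * [:P\<^sup>2 - 4 * Q:]" by simp
  also have "\<dots> \<equiv>\<^sub>M [:lucas_U P Q m:] * ((\<alpha> - \<beta>) * (\<alpha> - \<beta>))"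
    by (intro ideal_cong_mult_left ideal_cong_sym[OF AmB])
  also have "\<dots> = ([:lucas_U P Q m:] * (\<alpha> - \<beta>)) * (\<alpha> - \<beta>)" by (simp only: mult.assoc)
  also have "\<dots> \<equiv>\<^sub>M (\<alpha> ^ m - \<beta> ^ m) * (\<alpha> - \<beta>)"
    by (intro ideal_cong_mult_right lucas_U_AB)
  also have "\<dots> \<equiv>\<^sub>M (\<alpha> ^ m - \<alpha> ^ m) * (\<alpha> - \<beta>)"
    by (intro ideal_cong_mult_right ideal_cong_diff ideal_cong_sym[OF eq]) simp
  also have "\<dots> = [:0:]" by simp
  finally have "[lucas_U P Q m * (P\<^sup>2 - 4 * Q) = 0] (mod n)"
    by (rule ideal_cong_const_imp_cong) simp_all
  then show ?thesis
    using assms(2) by (simp add: cong_0_iff coprime_dvd_mult_left_iff)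
qed

lemma lucas_V_cong_0:
  fixes Q' :: int
  assumes "[Q' * Q = 1] (mod n)"
    and "ideal_cong [:n:] [:1, 2 - P\<^sup>2 * Q', 1:] ([:0, 1:] ^ m) (- 1)"
  shows "[lucas_V P Q m = 0] (mod n)"
proof -
  have eq: "\<alpha> ^ m \<equiv>\<^sub>M - (\<beta> ^ m)"
    using root_power_cong[of Q' m "-1"] assms by (simp add: one_pCons)
  have "[:lucas_V P Q m:] \<equiv>\<^sub>M \<alpha> ^ m + \<beta> ^ m" by (rule lucas_V_AB)
  also have "\<dots> \<equiv>\<^sub>M - (\<beta> ^ m) + \<beta> ^ m" by (intro ideal_cong_add eq) simp
  also have "\<dots> = [:0:]" by simp
  finally show ?thesis
    by (rule ideal_cong_const_imp_cong) simp_all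
qed

end

section \<open>Jacobi symbols and discriminants\<close>

lemma QuadRes_square_mult:
  fixes p u a :: int
  assumes "coprime u p"
  shows "QuadRes p (u\<^sup>2 * a) \<longleftrightarrow> QuadRes p a"
proof
  assume "QuadRes p a"
  then obtain y where "[y\<^sup>2 = a] (mod p)" unfolding QuadRes_def by blast
  then have "[(u * y)\<^sup>2 = u\<^sup>2 * a] (mod p)"
    by (simp add: power_mult_distrib cong_scalar_left)
  then show "QuadRes p (u\<^sup>2 * a)" unfolding QuadRes_def by blast
next
  assume "QuadRes p (u\<^sup>2 * a)"
  then obtain y where y: "[y\<^sup>2 = u\<^sup>2 * a] (mod p)" unfolding QuadRes_def by blast
  obtain v where v: "[u * v = 1] (mod p)" using cong_solve_coprime_int[OF assms] by blast
  have "[(v * y)\<^sup>2 = v\<^sup>2 * (u\<^sup>2 * a)] (mod p)"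
    using y by (simp add: power_mult_distrib cong_scalar_left)
  also have "v\<^sup>2 * (u\<^sup>2 * a) = (u * v)\<^sup>2 * a" by (simp add: power_mult_distrib)
  also have "[\<dots> = 1\<^sup>2 * a] (mod p)" by (intro cong_scalar_right cong_pow v)
  finally show "QuadRes p a" unfolding QuadRes_def by auto
qed

lemma Legendre_square_mult:
  fixes p u a :: int
  assumes "coprime u p"
  shows "Legendre (u\<^sup>2 * a) p = Legendre a p"
proof -
  have "coprime (u\<^sup>2) p" using assms by simp
  then have "[u\<^sup>2 * a = 0] (mod p) \<longleftrightarrow> [a = 0] (mod p)"
    by (simp add: cong_0_iff coprime_commute coprime_dvd_mult_right_iff)
  then show ?thesis using QuadRes_square_mult[OF assms] by (simp add: Legendre_def)
qed

lemma Legendre_cong: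
  assumes "[a = b] (mod p)"
  shows "Legendre a p = Legendre b p"
proof -
  have "[x = a] (mod p) \<longleftrightarrow> [x = b] (mod p)" for x
    using assms cong_trans cong_sym by blast
  moreover have "[a = 0] (mod p) \<longleftrightarrow> [b = 0] (mod p)"
    using assms cong_trans cong_sym by blast
  ultimately show ?thesis by (simp add: Legendre_def QuadRes_def)
qed

text \<open>Every prime factor of \<open>n\<close> inherits the coprimality and the congruence, so
  the Legendre symbols agree one by one.\<close>

lemma jacobi_square_mult_cong:
  fixes n u a b :: int
  assumes "coprime u n" "[b = u\<^sup>2 * a] (mod n)"
  shows "jacobi b n = jacobi a n"
proof -
  have "Legendre b p = Legendre a p" if "p \<in># prime_factorization n" for p
  proof -
    have "p dvd n" using that by (auto simp: in_prime_factors_iff)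
    then have "coprime u p" "[b = u\<^sup>2 * a] (mod p)"
      using assms by (auto intro: coprime_divisors[of u u] cong_dvd_modulus)
    then show ?thesis
      using Legendre_square_mult Legendre_cong by metis
  qed
  then show ?thesis
    unfolding jacobi_def by (metis (no_types, lifting) image_mset_cong)
qed

text \<open>Serves to expand the Sylvester matrix of a quadratic and its derivative.\<close>

lemma det_3:
  fixes M :: "'a::comm_ring_1 mat"
  assumes A: "M \<in> carrier_mat 3 3"
  shows "Determinant.det M =
     M $$ (0,0) * (M $$ (1,1) * M $$ (2,2) - M $$ (1,2) * M $$ (2,1))
   - M $$ (1,0) * (M $$ (0,1) * M $$ (2,2) - M $$ (0,2) * M $$ (2,1))
   + M $$ (2,0) * (M $$ (0,1) * M $$ (1,2) - M $$ (0,2) * M $$ (1,1))"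
proof -
  have two: "Determinant.det N = N $$ (0,0) * N $$ (1,1) - N $$ (1,0) * N $$ (0,1)"
    if N: "N \<in> carrier_mat 2 2" for N :: "'a mat"
  proof -
    have "Determinant.det N = (\<Sum>i<2. N $$ (i,0) * cofactor N i 0)"
      by (rule laplace_expansion_column[OF N]) simp
    also have "\<dots> = N $$ (0,0) * N $$ (1,1) - N $$ (1,0) * N $$ (0,1)"
      using N by (simp add: numeral_2_eq_2 cofactor_def det_single mat_delete_def)
    finally show ?thesis .
  qed
  have "Determinant.det M = (\<Sum>i<3. M $$ (i,0) * cofactor M i 0)"
    by (rule laplace_expansion_column[OF A]) simp
  then show ?thesis
    using A by (simp add: numeral_3_eq_3 numeral_2_eq_2 cofactor_def two[unfolded numeral_2_eq_2] mat_delete_def algebra_simps)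
qed

lemma discriminant_quadratic: "discriminant [:c, b, 1:] = b\<^sup>2 - 4 * c"
proof -
  have pd: "pderiv [:c, b, 1:] = [:b, 2:]" by (simp add: pderiv_pCons)
  define M where "M = sylvester_mat [:c, b, 1:] [:b, 2:]"
  have M: "M \<in> carrier_mat 3 3"
    using sylvester_carrier_mat[of "[:c, b, 1:]" "[:b, 2:]"] by (simp add: M_def numeral_3_eq_3)
  \<comment> \<open>Row 0 holds the quadratic; rows 1 and 2 hold shifted copies of its
    derivative.\<close>
  have ix: "M $$ (i, j) = (if i < 1 then if i \<le> j \<and> j - i \<le> 2 then Polynomial.coeff [:c, b, 1:] (2 + i - j) else 0
     else if i - 1 \<le> j \<and> j \<le> i then Polynomial.coeff [:b, 2:] (i - j) else 0)" if "i < 3" "j < 3" for i j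
    using sylvester_index_mat[of i "[:c, b, 1:]" "[:b, 2:]" j] that by (simp add: M_def numeral_2_eq_2)
  have "resultant [:c, b, 1:] [:b, 2:] = 4 * c - b\<^sup>2"
    unfolding resultant_def M_def[symmetric] det_3[OF M]
    by (simp add: ix power2_eq_square numeral_2_eq_2)
  then show ?thesis by (simp add: discriminant_def pd)
qed

section \<open>Polynomials over the residue ring\<close>

context
  fixes n :: int
  assumes n: "n > 1"
begin

interpretation residues n "residue_ring n"
  using n by unfold_locales

interpretation up: UP_cring "residue_ring n" "UP (residue_ring n)"
  by (rule UP_cring.intro) (rule cring)

abbreviation "Zn \<equiv> residue_ring n"
abbreviation "red \<equiv> reduce_poly n"

lemma carrier_Zn: "carrier Zn = {0..<n}"
  by (auto simp: residue_ring_def)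

lemma zero_Zn: "\<zero>\<^bsub>Zn\<^esub> = 0"
  by (simp add: residue_ring_def)

lemma mod_in_carrier_Zn [simp]: "a mod n \<in> carrier Zn"
  using n by (simp add: carrier_Zn)

lemma finsum_Zn:
  assumes "finite S"
  shows "(\<Oplus>\<^bsub>Zn\<^esub>i\<in>S. f i mod n) = (\<Sum>i\<in>S. f i) mod n"
  using assms
proof (induction S rule: finite_induct)
  case empty
  show ?case by (simp only: finsum_empty) (simp add: residue_ring_def)
next
  case (insert x S)
  then have "(\<Oplus>\<^bsub>Zn\<^esub>i\<in>insert x S. f i mod n) = (f x mod n) \<oplus>\<^bsub>Zn\<^esub> ((\<Sum>i\<in>S. f i) mod n)"
    by (subst finsum_insert) (auto simp del: mod_in_carrier_Zn intro: mod_in_carrier_Zn)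
  then show ?case using insert by (simp add: residue_ring_def mod_add_eq)
qed

lemma reduce_poly_in_up: "red p \<in> up Zn"
proof
  have "bound \<zero>\<^bsub>Zn\<^esub> (degree p) (red p)"
    by (rule bound.intro) (simp add: reduce_poly_def coeff_eq_0 residue_ring_def)
  then show "\<exists>k. bound \<zero>\<^bsub>Zn\<^esub> k (red p)" ..
qed (simp add: reduce_poly_def)

lemma reduce_poly_closed [simp]: "red p \<in> carrier (UP Zn)"
  using reduce_poly_in_up by (simp add: UP_def)

lemma coeff_reduce_poly: "up_ring.coeff (UP Zn) (red p) k = Polynomial.coeff p k mod n"
  by (simp add: UP_def reduce_poly_in_up) (simp add: reduce_poly_def)

lemma reduce_poly_add: "red (p + q) = red p \<oplus>\<^bsub>UP Zn\<^esub> red q"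
  by (simp add: UP_def reduce_poly_in_up)
     (simp add: reduce_poly_def residue_ring_def mod_add_eq)

lemma reduce_poly_mult: "red (p * q) = red p \<otimes>\<^bsub>UP Zn\<^esub> red q"
proof
  fix k
  have "(red p \<otimes>\<^bsub>UP Zn\<^esub> red q) k = (\<Oplus>\<^bsub>Zn\<^esub>i\<in>{..k}. red p i \<otimes>\<^bsub>Zn\<^esub> red q (k - i))"
    by (simp add: UP_def reduce_poly_in_up)
  also have "\<dots> = (\<Oplus>\<^bsub>Zn\<^esub>i\<in>{..k}. (Polynomial.coeff p i * Polynomial.coeff q (k - i)) mod n)"
    by (simp add: reduce_poly_def residue_ring_def mod_mult_eq)
  also have "\<dots> = red (p * q) k"
    by (simp add: finsum_Zn reduce_poly_def coeff_mult)
  finally show "red (p * q) k = (red p \<otimes>\<^bsub>UP Zn\<^esub> red q) k" ..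
qed

lemma reduce_poly_1: "red 1 = \<one>\<^bsub>UP Zn\<^esub>"
  using n by (auto simp: UP_def reduce_poly_def residue_ring_def coeff_1)

lemma reduce_poly_0: "red 0 = \<zero>\<^bsub>UP Zn\<^esub>"
  by (auto simp: UP_def reduce_poly_def residue_ring_def)

lemma reduce_poly_diff: "red (p - q) = red p \<ominus>\<^bsub>UP Zn\<^esub> red q"
proof -
  have "red p = red (p - q) \<oplus>\<^bsub>UP Zn\<^esub> red q" by (simp flip: reduce_poly_add)
  then show ?thesis by (simp add: up.P.minus_eq up.P.a_assoc up.P.r_neg)
qed

lemma reduce_poly_monom: "red (Polynomial.monom a k) = up_ring.monom (UP Zn) (a mod n) k"
proof
  fix i
  have "up_ring.monom (UP Zn) (a mod n) k i = (if i = k then a mod n else 0)"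
    by (simp add: UP_def) (simp add: residue_ring_def)
  then show "red (Polynomial.monom a k) i = up_ring.monom (UP Zn) (a mod n) k i"
    by (simp add: reduce_poly_def)
qed

lemma reduce_poly_X_power: "red ([:0, 1:] ^ k) = X_pow Zn k"
  using n reduce_poly_monom[of 1 k] by (simp add: monom_altdef residue_ring_def)

lemma reduce_poly_const: "red [:a:] = up_ring.monom (UP Zn) (a mod n) 0"
  using reduce_poly_monom[of a 0] by (simp add: monom_0)

lemma reduce_poly_power: "red (p ^ k) = red p [^]\<^bsub>UP Zn\<^esub> k"
  by (induction k) (simp_all add: reduce_poly_1 reduce_poly_mult up.P.m_comm)

lemma reduce_poly_sum:
  "finite S \<Longrightarrow> red (\<Sum>i\<in>S. f i) = (\<Oplus>\<^bsub>UP Zn\<^esub>i\<in>S. red (f i))"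
  by (induction S rule: finite_induct) (auto simp: reduce_poly_0 reduce_poly_add)

lemma reduce_poly_prod:
  "finite S \<Longrightarrow> red (\<Prod>i\<in>S. f i) = (\<Otimes>\<^bsub>UP Zn\<^esub>i\<in>S. red (f i))"
  by (induction S rule: finite_induct) (auto simp: reduce_poly_1 reduce_poly_mult)

section \<open>Kernel of the reduction modulo \<open>n\<close>, and lifts to integer
  polynomials\<close>

lemma reduce_poly_eq_iff: "red p = red q \<longleftrightarrow> [:n:] dvd p - q"
proof
  assume "red p = red q"
  then have "n dvd Polynomial.coeff (p - q) k" for k
    unfolding reduce_poly_def fun_eq_iff by (simp add: mod_eq_dvd_iff)
  then show "[:n:] dvd p - q" by (simp add: const_poly_dvd_iff)
next
  assume "[:n:] dvd p - q"
  then show "red p = red q"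
    unfolding reduce_poly_def fun_eq_iff const_poly_dvd_iff by (simp add: mod_eq_dvd_iff)
qed

lemma deg_reduce_poly_monic:
  assumes "lead_coeff p = 1"
  shows "deg Zn (red p) = degree p"
proof (rule antisym)
  show "deg Zn (red p) \<le> degree p"
    by (rule up.deg_aboveI) (simp_all add: coeff_reduce_poly zero_Zn coeff_eq_0)
  show "degree p \<le> deg Zn (red p)"
    using n assms by (intro up.deg_belowI) (simp_all add: coeff_reduce_poly zero_Zn)
qed

text \<open>Residues are the integers from 0 to \<open>n - 1\<close>, so the coefficient function of
  \<open>p\<close> is itself that of a lift.\<close>

lemma reduce_poly_surj:
  assumes "p \<in> carrier (UP Zn)"
  obtains q where "p = red q" "\<And>k. Polynomial.coeff q k = p k"
proof -
  have p: "p \<in> up Zn" using assms by (simp add: UP_def)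
  then obtain b where b: "bound \<zero>\<^bsub>Zn\<^esub> b p" by (auto simp: up_def)
  have c: "Polynomial.coeff (Abs_poly p) = p"
    by (rule coeff_Abs_poly[of b]) (use b in \<open>auto simp: bound_def residue_ring_def\<close>)
  have "p k mod n = p k" for k
    using mem_upD[OF p, of k] by (simp add: carrier_Zn)
  then have "p = red (Abs_poly p)" by (simp add: reduce_poly_def c)
  then show thesis using that c by metis
qed

text \<open>The one of \<open>Zn\<close> is the integer 1, and the canonical lift adds no higher
  coefficients; it is therefore monic over the integers.\<close>

lemma monic_UP_lift:
  assumes "monic_UP Zn p"
  obtains q where "p = red q" "lead_coeff q = 1" 
proof -
  have p: "p \<in> carrier (UP Zn)" and lc: "up_ring.coeff (UP Zn) p (deg Zn p) = 1"
    using assms by (auto simp: monic_UP_def residue_ring_def)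
  obtain q where q: "p = red q" "\<And>k. Polynomial.coeff q k = p k"
    using reduce_poly_surj[OF p] by metis
  have pk: "up_ring.coeff (UP Zn) p k = p k" for k using p by (simp add: UP_def)
  have "Polynomial.coeff q (deg Zn p) = 1" using lc q pk by simp
  moreover have "Polynomial.coeff q k = 0" if "k > deg Zn p" for k
    using up.deg_aboveD[OF that p] pk q by (simp add: residue_ring_def)
  ultimately have "degree q = deg Zn p"
    by (metis le_degree leading_coeff_0_iff linorder_neqE_nat not_le zero_neq_one degree_0 le_zero_eq)
  then show thesis using that q \<open>Polynomial.coeff q (deg Zn p) = 1\<close> by metis
qed

lemma reduce_poly_factor:
  assumes "red a = x \<otimes>\<^bsub>UP Zn\<^esub> red h" "x \<in> carrier (UP Zn)"
  shows "ideal_cong [:n:] h a 0"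
proof -
  obtain u where "x = red u" using reduce_poly_surj[OF assms(2)] by metis
  then have "[:n:] dvd a - u * h" using assms by (simp add: reduce_poly_mult flip: reduce_poly_eq_iff)
  then obtain v where "a - u * h = [:n:] * v" by (elim dvdE)
  then have "a - 0 = [:n:] * v + h * u" by (simp add: algebra_simps)
  then show ?thesis by (rule ideal_congI)
qed

text \<open>Turns the equality of ideals into congruences: \<open>h'\<close> divides
  \<open>a\<close> and \<open>b\<close> modulo \<open>n\<close>, and a Bezout relation
  \<open>h' = a u + b v\<close> holds modulo \<open>n\<close>, stated modulo
  \<open>(n, b)\<close>.\<close>

lemma is_gcmd_lift:
  assumes "is_gcmd Zn (red a) (red b) h"
  obtains h' u where "h = red h'" "lead_coeff h' = 1"
    "ideal_cong [:n:] h' a 0" "ideal_cong [:n:] h' b 0" "ideal_cong [:n:] b h' (a * u)"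
proof -
  have monic: "monic_UP Zn h" and idl: "Idl\<^bsub>UP Zn\<^esub> {red a, red b} = Idl\<^bsub>UP Zn\<^esub> {h}"
    using assms by (auto simp: is_gcmd_def)
  obtain h' where h': "h = red h'" "lead_coeff h' = 1" using monic_UP_lift[OF monic] by metis
  have "Idl\<^bsub>UP Zn\<^esub> {h} = PIdl\<^bsub>UP Zn\<^esub> h"
    unfolding h' by (rule up.P.cgenideal_eq_genideal[symmetric]) simp
  moreover have "{red a, red b} \<subseteq> Idl\<^bsub>UP Zn\<^esub> {red a, red b}"
    by (rule up.P.genideal_self) simp
  ultimately have "red a \<in> PIdl\<^bsub>UP Zn\<^esub> h" "red b \<in> PIdl\<^bsub>UP Zn\<^esub> h" using idl by auto
  then have 1: "ideal_cong [:n:] h' a 0" "ideal_cong [:n:] h' b 0"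
    unfolding cgenideal_def h' by (auto intro: reduce_poly_factor)
  \<comment> \<open>The sum of the two principal ideals contains the ideal generated by both
    polynomials, so membership of \<open>h\<close> yields explicit Bezout coefficients.\<close>
  define I where "I = PIdl\<^bsub>UP Zn\<^esub> (red a) <+>\<^bsub>UP Zn\<^esub> PIdl\<^bsub>UP Zn\<^esub> (red b)"
  have I: "ideal I (UP Zn)"
    unfolding I_def by (intro up.P.add_ideals up.P.cgenideal_ideal) simp_all
  have pa: "red a \<in> PIdl\<^bsub>UP Zn\<^esub> (red a)" "red b \<in> PIdl\<^bsub>UP Zn\<^esub> (red b)"
    by (simp_all add: up.P.cgenideal_self)
  have z: "\<zero>\<^bsub>UP Zn\<^esub> \<in> PIdl\<^bsub>UP Zn\<^esub> (red p)" for p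
    using up.P.cgenideal_ideal[of "red p"] by (simp add: ideal.axioms(1) additive_subgroup.zero_closed)
  have I_memI: "x \<oplus>\<^bsub>UP Zn\<^esub> y \<in> I" if "x \<in> PIdl\<^bsub>UP Zn\<^esub> (red a)" "y \<in> PIdl\<^bsub>UP Zn\<^esub> (red b)" for x y
    using that unfolding I_def set_add_def' by blast
  have "red a \<in> I" "red b \<in> I"
    using I_memI[OF pa(1) z] I_memI[OF z pa(2)] by simp_all
  then have "Idl\<^bsub>UP Zn\<^esub> {red a, red b} \<subseteq> I"
    by (intro up.P.genideal_minimal I) simp
  moreover have "h \<in> Idl\<^bsub>UP Zn\<^esub> {h}" unfolding h' by (rule up.P.genideal_self') simp
  ultimately have "h \<in> I" using idl by auto
  then obtain x y where xy: "x \<in> carrier (UP Zn)" "y \<in> carrier (UP Zn)"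
      "h = x \<otimes>\<^bsub>UP Zn\<^esub> red a \<oplus>\<^bsub>UP Zn\<^esub> y \<otimes>\<^bsub>UP Zn\<^esub> red b"
    unfolding I_def set_add_def' cgenideal_def by auto
  obtain u v where uv: "x = red u" "y = red v" using reduce_poly_surj xy by metis
  have "red h' = red (u * a + v * b)"
    using xy(3) unfolding uv h' by (simp add: reduce_poly_mult reduce_poly_add)
  then obtain w where "h' - (u * a + v * b) = [:n:] * w" by (auto simp: reduce_poly_eq_iff elim: dvdE)
  then have "h' - a * u = [:n:] * w + b * v" by (simp add: algebra_simps)
  then have "ideal_cong [:n:] b h' (a * u)" by (rule ideal_congI)
  with 1 h' show thesis using that by blast
qed

text \<open>For monic \<open>p\<close>, reduction preserves the degree, so \<open>eval\<close> sums
  over the same range as the expansion of \<open>pcompose\<close>.\<close>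

lemma subst_X_pow_reduce_poly:
  assumes "lead_coeff p = 1"
  shows "subst_X_pow Zn k (red p) = red (pcompose p ([:0, 1:] ^ k))"
proof -
  have "pcompose p ([:0, 1:] ^ k) = (\<Sum>i\<le>degree p. [:Polynomial.coeff p i:] * ([:0, 1:] ^ k) ^ i)"
    unfolding pcompose_altdef poly_altdef by (simp add: coeff_map_poly degree_map_poly)
  then have "red (pcompose p ([:0, 1:] ^ k))
     = (\<Oplus>\<^bsub>UP Zn\<^esub>i\<in>{..degree p}. up_ring.monom (UP Zn) (Polynomial.coeff p i mod n) 0 \<otimes>\<^bsub>UP Zn\<^esub> X_pow Zn k [^]\<^bsub>UP Zn\<^esub> i)"
    by (simp only: reduce_poly_sum finite_atMost reduce_poly_mult reduce_poly_power[of "[:0, 1:] ^ k"]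
          reduce_poly_X_power reduce_poly_const)
  then show ?thesis
    by (simp add: subst_X_pow_def eval_def coeff_reduce_poly deg_reduce_poly_monic[OF assms])
qed

end

section \<open>Frobenius pseudoprimes for palindromic quadratics\<close>

text \<open>Here \<open>X^2 + b X + 1\<close> is \<open>(X - a)(X - a')\<close> modulo
  \<open>n\<close>. From \<open>a' = 1 / a\<close> and \<open>e = 1 / e\<close> the congruence
  passes to \<open>a'\<close>; because \<open>(a - a')^2 = b^2 - 4\<close> is a unit, the
  congruences at both roots combine to one modulo the quadratic.\<close>

lemma power_cong_of_linear_factors:
  fixes n a a' b e :: int
  assumes aa: "[a * a' = 1] (mod n)" and sum: "[a + a' = - b] (mod n)"
    and unit: "coprime (b\<^sup>2 - 4) n" and e: "e * e = 1"
    and am: "[a ^ m = e] (mod n)"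
  shows "ideal_cong [:n:] [:1, b, 1:] ([:0, 1:] ^ m) [:e:]"
proof -
  let ?C = "ideal_cong [:n:] [:1, b, 1:]"
  have "[e * a' ^ m = a ^ m * a' ^ m] (mod n)" by (intro cong_scalar_right cong_sym[OF am])
  also have "a ^ m * a' ^ m = (a * a') ^ m" by (simp add: power_mult_distrib)
  also have "[\<dots> = 1 ^ m] (mod n)" by (rule cong_pow[OF aa])
  finally have "[e * (e * a' ^ m) = e * 1] (mod n)" by (intro cong_scalar_left) simp
  then have a'm: "[a' ^ m = e] (mod n)" using e by (simp flip: mult.assoc)
  define T where "T = [:0, 1:] ^ m - [:e:]"
  \<comment> \<open>Modulo \<open>n\<close>, the factor \<open>X - x\<close> divides
    \<open>T\<close>, so \<open>(X - y) T\<close> is a multiple of the quadratic.\<close>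
  have lin: "?C ([:- y, 1:] * T) 0" if x: "[x ^ m = e] (mod n)" and xy: "[x * y = 1] (mod n)" "[x + y = - b] (mod n)" for x y
  proof -
    have "poly ([:0, 1:] ^ m - [:x ^ m:]) x = 0" by (simp add: poly_power)
    then obtain q where q: "[:0, 1:] ^ m - [:x ^ m:] = [:- x, 1:] * q"
      by (metis poly_eq_0_iff_dvd dvdE)
    have "T = [:- x, 1:] * q + ([:x ^ m:] - [:e:])"
      unfolding T_def q[symmetric] by (simp only: add_diff_eq diff_add_cancel)
    then have "[:- y, 1:] * T = [:- y, 1:] * ([:- x, 1:] * q) + [:- y, 1:] * ([:x ^ m:] - [:e:])"
      by (simp only: distrib_left)
    \<comment> \<open>\<open>(X - y)(X - x)\<close> is the quadratic plus two errors, in its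
      constant and its linear term, that vanish modulo \<open>n\<close>.\<close>
    also have "\<dots> = ([:1, b, 1:] + ([:x * y:] - [:1:]) - ([:x + y:] - [:-b:]) * [:0, 1:]) * q + [:- y, 1:] * ([:x ^ m:] - [:e:])"
      unfolding mult.assoc[symmetric] by simp
    also have "?C \<dots> ((0 + ([:1:] - [:1:]) - ([:-b:] - [:-b:]) * [:0, 1:]) * q + [:- y, 1:] * ([:e:] - [:e:]))"
      by (intro ideal_cong_add ideal_cong_mult_left ideal_cong_mult_right ideal_cong_diff ideal_cong_const x xy
         ideal_cong_refl ideal_congI[of _ 0 _ 0 _ 1]) simp
    finally show ?thesis by simp
  qed
  have 1: "?C ([:- a', 1:] * T) 0" by (rule lin[OF am aa sum])
  have 2: "?C ([:- a, 1:] * T) 0"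
    by (rule lin[OF a'm]) (use aa sum in \<open>simp_all add: mult.commute add.commute\<close>)
  \<comment> \<open>The difference of the two multiples of \<open>T\<close> is
    \<open>(a - a') T\<close>; one more factor \<open>a - a'\<close> makes the coefficient the
    discriminant.\<close>
  have "?C ([:a - a':] * ([:- a', 1:] * T - [:- a, 1:] * T)) ([:a - a':] * (0 - 0))"
    by (intro ideal_cong_mult_left ideal_cong_diff 1 2)
  moreover have "[:- a', 1:] * T - [:- a, 1:] * T = [:a - a':] * T"
    unfolding left_diff_distrib[symmetric] by simp
  ultimately have "?C ([:(a - a')\<^sup>2:] * T) 0"
    by (simp add: power2_eq_square)
  moreover have "[(a - a')\<^sup>2 = b\<^sup>2 - 4] (mod n)"
  proof -
    have "(a - a')\<^sup>2 = (a + a')\<^sup>2 - 4 * (a * a')" by (simp add: power2_eq_square algebra_simps)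
    also have "[\<dots> = (- b)\<^sup>2 - 4 * 1] (mod n)"
      by (intro cong_diff cong_pow cong_scalar_left aa sum)
    finally show ?thesis by simp
  qed
  ultimately have T0: "?C ([:b\<^sup>2 - 4:] * T) ([:b\<^sup>2 - 4:] * 0)"
    using ideal_cong_trans[OF ideal_cong_mult_right[OF ideal_cong_sym[OF ideal_cong_const]]] by simp
  obtain d where d: "[(b\<^sup>2 - 4) * d = 1] (mod n)"
    using cong_solve_coprime_int[OF unit] by blast
  have "?C ([:b\<^sup>2 - 4:] * [:d:]) 1"
    using ideal_cong_const[OF d, of "[:1, b, 1:]"] by (simp add: one_pCons mult.commute)
  from ideal_cong_cancel_unit[OF this T0] show ?thesis
    unfolding T_def by (simp only: ideal_cong_diff_0_iff)
qed

lemma monic_degree_1: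
  fixes p :: "'a::comm_ring_1 poly"
  assumes "lead_coeff p = 1" "degree p = 1"
  obtains a where "p = [:- a, 1:]"
proof -
  obtain a c where p: "p = [:a, c:]" using degree1_coeffs[OF assms(2)] by metis
  have "c = 1" using assms unfolding p by (simp split: if_splits)
  then have "p = [:- (- a), 1:]" using p by simp
  then show thesis by (rule that)
qed

lemma degree_eq_if_const_dvd_diff:
  fixes n :: int
  assumes "n > 1" "lead_coeff p = 1" "lead_coeff q = 1" "[:n:] dvd p - q"
  shows "degree p = degree q"
  using assms deg_reduce_poly_monic[of n p] deg_reduce_poly_monic[of n q] reduce_poly_eq_iff[of n p q] by simp

text \<open>The monic factors have total degree 2, so some \<open>g j\<close> is not constant.
  Either it is the whole quadratic modulo \<open>n\<close>, or the quadratic splits and one root of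
  \<open>g j\<close> suffices.\<close>

lemma power_cong_of_factorization:
  fixes n b :: int and g :: "'a \<Rightarrow> int poly" and e :: "'a \<Rightarrow> int"
  assumes n: "n > 1" and unit: "coprime (b\<^sup>2 - 4) n" and S: "finite S"
    and fact: "[:n:] dvd [:1, b, 1:] - (\<Prod>j\<in>S. g j)"
    and monic: "\<And>j. j \<in> S \<Longrightarrow> lead_coeff (g j) = 1"
    and e: "\<And>j. j \<in> S \<Longrightarrow> e j * e j = 1"
    and cong: "\<And>j. j \<in> S \<Longrightarrow> ideal_cong [:n:] (g j) ([:0, 1:] ^ m j) [:e j:]"
  obtains j where "j \<in> S" "ideal_cong [:n:] [:1, b, 1:] ([:0, 1:] ^ m j) [:e j:]"
proof -
  have monic_prod: "lead_coeff (\<Prod>j\<in>T. g j) = 1" if "T \<subseteq> S" for T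
    using that monic by (auto simp: lead_coeff_prod intro!: prod.neutral)
  have deg2: "degree (\<Prod>j\<in>S. g j) = 2"
    using degree_eq_if_const_dvd_diff[OF n _ monic_prod fact] by simp
  have "\<exists>j\<in>S. degree (g j) \<noteq> 0"
  proof (rule ccontr)
    assume "\<not> ?thesis"
    then have "degree (\<Prod>j\<in>S. g j) \<le> 0"
      using degree_prod_sum_le[OF S, of g] by (simp add: o_def)
    then show False using deg2 by simp
  qed
  then obtain j where j: "j \<in> S" "degree (g j) \<noteq> 0" by blast
  define h where "h = (\<Prod>i\<in>S - {j}. g i)"
  have h: "(\<Prod>j\<in>S. g j) = g j * h" unfolding h_def by (rule prod.remove[OF S j(1)])
  have monic_h: "lead_coeff h = 1" unfolding h_def by (rule monic_prod) auto
  have "degree (g j * h) = degree (g j) + degree h"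
    by (rule degree_mult_eq) (use monic_h monic[OF j(1)] in auto)
  then have deg: "degree (g j) + degree h = 2" using deg2 h by simp
  have "ideal_cong [:n:] [:1, b, 1:] ([:0, 1:] ^ m j) [:e j:]"
  proof (cases "degree (g j) = 2")
    case True
    then have "degree h = 0" using deg by simp
    then have "h = 1" using monic_h by (metis degree_0_id one_pCons)
    then have "[:n:] dvd g j - [:1, b, 1:]"
      using fact h dvd_minus_iff[of "[:n:]" "[:1, b, 1:] - g j"] by simp
    from ideal_cong_change_modulus[OF this cong[OF j(1)]] show ?thesis .
  next
    case False
    then have "degree (g j) = 1" "degree h = 1" using deg j(2) by auto
    then obtain a a' where a: "g j = [:- a, 1:]" and a': "h = [:- a', 1:]"
      using monic_degree_1 monic[OF j(1)] monic_h by metis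
    \<comment> \<open>Coefficients 0 and 1 give the product and the sum of the roots.\<close>
    have c: "n dvd Polynomial.coeff ([:1, b, 1:] - [:- a, 1:] * [:- a', 1:]) k" for k
      using fact unfolding h a a' const_poly_dvd_iff by blast
    have "n dvd 1 - a * a'" using c[of 0] by (simp add: mult.commute)
    then have 1: "[a * a' = 1] (mod n)" by (simp add: cong_iff_dvd_diff dvd_diff_commute)
    have "n dvd b + (a + a')" using c[of 1] by (simp add: algebra_simps)
    then have 2: "[a + a' = - b] (mod n)" by (simp add: cong_iff_dvd_diff algebra_simps)
    \<comment> \<open>Evaluation at \<open>a\<close> kills the multiple of \<open>X - a\<close> and
      leaves an integer congruence.\<close>
    obtain u v where "[:0, 1:] ^ m j - [:e j:] = [:n:] * u + [:- a, 1:] * v"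
      using cong[OF j(1)] unfolding a ideal_cong_def by blast
    then have "poly ([:0, 1:] ^ m j - [:e j:]) a = poly ([:n:] * u + [:- a, 1:] * v) a" by simp
    then have "a ^ m j - e j = n * poly u a" by (simp add: poly_power)
    then have "[a ^ m j = e j] (mod n)" by (simp add: cong_iff_dvd_diff)
    from power_cong_of_linear_factors[OF 1 2 unit e[OF j(1)] this] show ?thesis .
  qed
  with j show thesis using that by blast
qed

text \<open>\<open>Y = X^N\<close> is a root as well, and
  \<open>f(Y) - f(X) = (Y - X)(Y + X + b)\<close>. Cancelling the unit \<open>Y - X\<close> shows
  that \<open>Y\<close> is the conjugate root \<open>-b - X\<close>.\<close>

lemma frobenius_conjugate:
  fixes n b :: int
  assumes unit: "ideal_cong [:n:] [:1, b, 1:] 1 (([:0, 1:] ^ N - [:0, 1:]) * u)"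
    and frob: "ideal_cong [:n:] [:1, b, 1:] (pcompose [:1, b, 1:] ([:0, 1:] ^ N)) 0"
  shows "ideal_cong [:n:] [:1, b, 1:] ([:0, 1:] ^ Suc N) 1"
proof -
  let ?C = "ideal_cong [:n:] [:1, b, 1:]"
  define X :: "int poly" where "X = [:0, 1:]"
  define Y where "Y = X ^ N"
  have fX: "X * X + [:b:] * X + 1 = [:1, b, 1:]" by (simp add: X_def one_pCons)
  have root: "?C (X * X + [:b:] * X + 1) 0"
    unfolding fX by (rule ideal_congI[of _ _ _ 0 _ 1]) simp
  have "pcompose [:1, b, 1:] ([:0, 1:] ^ N) = Y * Y + [:b:] * Y + 1"
    by (simp add: pcompose_pCons Y_def X_def one_pCons algebra_simps)
  then have "?C (Y * Y + [:b:] * Y + 1 - (X * X + [:b:] * X + 1)) (0 - 0)"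
    using frob root by (intro ideal_cong_diff) simp_all
  moreover have "Y * Y + c * Y + 1 - (X * X + c * X + 1) = (Y - X) * (Y + X + c)" for c
    by (simp add: algebra_simps)
  ultimately have "?C ((Y - X) * (Y + X + [:b:])) ((Y - X) * 0)"
    by (simp only: diff_self mult_zero_right)
  then have "?C (Y + X + [:b:]) 0"
    using ideal_cong_cancel_unit[OF ideal_cong_sym[OF unit]] unfolding Y_def X_def by blast
  \<comment> \<open>Multiplying by \<open>X\<close> and subtracting \<open>f(X)\<close> leaves
    \<open>X Y - 1\<close>.\<close>
  then have "?C (X * (Y + X + [:b:]) - (X * X + [:b:] * X + 1)) (X * 0 - 0)"
    by (intro ideal_cong_diff ideal_cong_mult_left root)
  moreover have "X * (Y + X + [:b:]) - (X * X + [:b:] * X + 1) = X ^ Suc N - 1"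
    by (simp add: algebra_simps Y_def)
  ultimately have "?C (X ^ Suc N - 1) 0" by (simp only: diff_self mult_zero_right)
  then show ?thesis unfolding ideal_cong_diff_0_iff X_def .
qed


text \<open>The gcmds lift to monic integer polynomials whose product is the quadratic modulo
  \<open>n\<close>, each dividing some \<open>X^m - e\<close> with \<open>e\<close> a sign. Used
  with \<open>i = 1\<close> and \<open>i = 2\<close>.\<close>

lemma square_root_step_cong:
  fixes n b :: int
  assumes step: "square_root_step n f F" and i: "i \<in> {1..degree f}" and Fi: "F i = reduce_poly n [:1, b, 1:]"
    and n: "n > 1" and unit: "coprime (b\<^sup>2 - 4) n"
  obtains r s where "odd s" "nat n ^ i - 1 = 2 ^ r * s"
    "ideal_cong [:n:] [:1, b, 1:] ([:0, 1:] ^ s) 1 \<or>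
     (\<exists>t<r. ideal_cong [:n:] [:1, b, 1:] ([:0, 1:] ^ (2 ^ t * s)) (-1))"
proof -
  let ?R = "residue_ring n"
  obtain r s G where rs: "odd s" "nat n ^ i - 1 = 2 ^ r * s"
    and G0: "is_gcmd ?R (F i) (X_pow ?R s \<ominus>\<^bsub>UP ?R\<^esub> \<one>\<^bsub>UP ?R\<^esub>) (G 0)"
    and Gj: "\<And>j. j \<in> {1..r} \<Longrightarrow> is_gcmd ?R (F i) (X_pow ?R (2 ^ (j - 1) * s) \<oplus>\<^bsub>UP ?R\<^esub> \<one>\<^bsub>UP ?R\<^esub>) (G j)"
    and prod: "F i = (\<Otimes>\<^bsub>UP ?R\<^esub>j\<in>{0..r}. G j)"
    using step i unfolding square_root_step_def Let_def by metis
  \<comment> \<open>One family of exponents and signs covers both \<open>X^s - 1\<close> and the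
    polynomials with \<open>+ 1\<close>.\<close>
  define m where "m j = (if j = 0 then s else 2 ^ (j - 1) * s)" for j :: nat
  define e :: "nat \<Rightarrow> int" where "e j = (if j = 0 then 1 else -1)" for j
  have "\<exists>g. G j = reduce_poly n g \<and> lead_coeff g = 1 \<and> ideal_cong [:n:] g ([:0, 1:] ^ m j) [:e j:]"
    if "j \<in> {0..r}" for j
  proof -
    have "is_gcmd ?R (reduce_poly n [:1, b, 1:]) (reduce_poly n ([:0, 1:] ^ m j - [:e j:])) (G j)"
    proof (cases "j = 0")
      case True
      have eq: "[:0, 1:] ^ m j - [:e j:] = [:0, 1:] ^ m j - 1"
        using True by (simp add: e_def one_pCons)
      show ?thesis
        unfolding eq using G0 True by (simp add: Fi reduce_poly_diff[OF n] reduce_poly_X_power[OF n] reduce_poly_1[OF n] m_def)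
    next
      case False
      have eq: "[:0, 1:] ^ m j - [:e j:] = [:0, 1:] ^ m j + 1"
        using False by (simp add: e_def one_pCons)
      show ?thesis
        unfolding eq using Gj[of j] that False
        by (simp add: Fi reduce_poly_add[OF n] reduce_poly_X_power[OF n] reduce_poly_1[OF n] m_def)
    qed
    from is_gcmd_lift[OF n this] show ?thesis
      by (metis ideal_cong_diff_0_iff)
  qed
  then obtain g where g: "\<And>j. j \<in> {0..r} \<Longrightarrow> G j = reduce_poly n (g j)"
      "\<And>j. j \<in> {0..r} \<Longrightarrow> lead_coeff (g j) = 1"
      "\<And>j. j \<in> {0..r} \<Longrightarrow> ideal_cong [:n:] (g j) ([:0, 1:] ^ m j) [:e j:]"
    by metis
  have "reduce_poly n (\<Prod>j\<in>{0..r}. g j) = (\<Otimes>\<^bsub>UP ?R\<^esub>j\<in>{0..r}. reduce_poly n (g j))"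
    by (rule reduce_poly_prod[OF n]) simp
  also have "\<dots> = F i"
    unfolding prod
  proof (rule comm_monoid.finprod_cong')
    have "UP_cring ?R" using n by (intro UP_cring.intro residues.cring residues.intro) 
    then show "comm_monoid (UP ?R)" by (rule UP_cring.UP_cring[THEN cring.axioms(2)])
  qed (use g(1) reduce_poly_closed[OF n] in auto)
  finally have fact: "[:n:] dvd [:1, b, 1:] - (\<Prod>j\<in>{0..r}. g j)"
    unfolding Fi using reduce_poly_eq_iff[OF n] by metis
  have e: "e j * e j = 1" for j by (simp add: e_def)
  obtain j where j: "j \<in> {0..r}" and "ideal_cong [:n:] [:1, b, 1:] ([:0, 1:] ^ m j) [:e j:]"
    using power_cong_of_factorization[OF n unit finite_atLeastAtMost fact g(2) e g(3)] by blast
  moreover have "[:- 1:] = (- 1 :: int poly)" by (simp add: one_pCons)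
  ultimately have "ideal_cong [:n:] [:1, b, 1:] ([:0, 1:] ^ s) 1 \<or>
     (\<exists>t<r. ideal_cong [:n:] [:1, b, 1:] ([:0, 1:] ^ (2 ^ t * s)) (-1))"
  proof (cases "j = 0")
    case False
    \<comment> \<open>The gcmds with sign -1 are indexed from 1 to \<open>r\<close>, whereas
      \<open>t\<close> starts at 0.\<close>
    then have "j - 1 < r" using j by simp
    with False \<open>[:- 1:] = - 1\<close> \<open>ideal_cong _ _ ([:0, 1:] ^ m j) _\<close> show ?thesis
      unfolding m_def e_def by auto
  qed (simp add: m_def e_def flip: one_pCons)
  with rs show thesis using that by blast
qed

section \<open>Odd parts of exponents when \<open>X^(n+1) = 1\<close>\<close>

lemma two_power_times_odd:
  fixes k :: nat
  assumes "k > 0"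
  obtains r s where "k = 2 ^ r * s" "odd s"
proof -
  have "\<exists>r s. k = 2 ^ r * s \<and> odd s"
    using assms
  proof (induction k rule: less_induct)
    case (less k)
    show ?case
    proof (cases "odd k")
      case True
      then show ?thesis by (intro exI[of _ 0] exI[of _ k]) simp
    next
      case False
      then obtain l where l: "k = 2 * l" by blast
      then obtain r s where "l = 2 ^ r * s" "odd s" using less by (metis mult_0_right nat_less_le less_mult_imp_div_less mult_2 less_add_same_cancel1 gr0I)
      then show ?thesis using l by (intro exI[of _ "Suc r"] exI[of _ s]) simp
    qed
  qed
  then show thesis using that by blast
qed

lemma conjugate_case_power_cong:
  fixes n b :: int
  assumes n: "n > 1" "odd n"
    and conj: "ideal_cong [:n:] [:1, b, 1:] ([:0, 1:] ^ Suc (nat n)) 1"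
    and rs: "odd s" "nat n ^ 2 - 1 = 2 ^ r * s"
    and alt: "ideal_cong [:n:] [:1, b, 1:] ([:0, 1:] ^ s) 1 \<or>
     (\<exists>t<r. ideal_cong [:n:] [:1, b, 1:] ([:0, 1:] ^ (2 ^ t * s)) (-1))"
  obtains r' s' where "odd s'" "Suc (nat n) = 2 ^ r' * s'"
    "ideal_cong [:n:] [:1, b, 1:] ([:0, 1:] ^ s') 1 \<or>
     (\<exists>t<r'. ideal_cong [:n:] [:1, b, 1:] ([:0, 1:] ^ (2 ^ t * s')) (-1))"
proof -
  let ?C = "ideal_cong [:n:] [:1, b, 1:]"
  obtain r' s' where r's': "Suc (nat n) = 2 ^ r' * s'" "odd s'"
    using two_power_times_odd[of "Suc (nat n)"] by auto
  \<comment> \<open>Oddness of \<open>n\<close> ensures \<open>r' > 0\<close>, as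
    \<open>ideal_cong_odd_power\<close> demands.\<close>
  have "even (Suc (nat n))" using n by (simp add: even_nat_iff)
  then have r': "r' > 0" using r's' by (cases r') auto
  have "nat n ^ 2 - 1 = Suc (nat n) * (nat n - 1)"
    by (simp add: power2_eq_square algebra_simps)
  then have "s' dvd 2 ^ r * s" using rs(2) r's'(1) by (metis dvd_mult2 dvd_triv_right)
  moreover have "coprime s' (2 ^ r)" using r's'(2) by simp
  ultimately have "s' dvd s" by (simp add: coprime_dvd_mult_right_iff)
  then obtain k where k: "s = s' * k" by blast
  then have odd_k: "odd k" using rs(1) by simp
  define y where "y = ([:0, 1:] :: int poly) ^ s'"
  have y: "?C (y ^ 2 ^ r') 1"
    using conj unfolding r's'(1) y_def by (simp flip: power_mult add: mult.commute)
  have nontrivial: "\<not> ?C 1 (-1)"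
  proof
    assume "?C 1 (-1)"
    then have "?C [:1:] [:-1:]" by (simp add: one_pCons)
    then have "[1 = -1] (mod n)" by (rule ideal_cong_const_imp_cong) simp_all
    then have "n dvd 2" by (simp add: cong_iff_dvd_diff)
    then have "n \<le> 2" by (rule zdvd_imp_le) simp
    then show False using n by presburger
  qed
  from alt have "?C y 1 \<or> (\<exists>t<r'. ?C (y ^ 2 ^ t) (-1))"
  proof (elim disjE exE conjE)
    assume "?C ([:0, 1:] ^ s) 1"
    then have "?C (y ^ k) 1" by (simp add: y_def k power_mult)
    then show ?thesis using ideal_cong_odd_power[OF y _ odd_k r'] by blast
  next
    fix t assume "?C ([:0, 1:] ^ (2 ^ t * s)) (-1)"
    then have "?C (y ^ (2 ^ t * k)) (-1)"
      by (simp add: y_def k mult_ac flip: power_mult)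
    then show ?thesis using ideal_cong_two_power_order[OF nontrivial y _ odd_k] by blast
  qed
  moreover have "y ^ 2 ^ t = [:0, 1:] ^ (2 ^ t * s')" for t
    by (simp add: y_def mult.commute flip: power_mult)
  ultimately show thesis
    using that[OF r's'(2,1)] y_def by simp
qed

section \<open>From the Frobenius steps for the quadratic to the Lucas congruences\<close>

theorem theorem5p5:
  fixes P Q Q' \<Delta> n :: int
  assumes "\<Delta> = P^2 - 4 * Q"
    and "gcd n (2 * \<Delta> * Q) = 1"
    and "[Q' * Q = 1] (mod n)"
    and "strong_frobenius_pseudoprime n [:1, 2 - P^2 * Q', 1:]"
  shows "strong_lucas_pseudoprime P Q n"
proof -
  define b where "b = 2 - P\<^sup>2 * Q'"
  define f where "f = [:1, b, 1:]"
  let ?R = "residue_ring n" and ?C = "ideal_cong [:n:] [:1, b, 1:]"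
  have deg_f: "degree f = 2" by (simp add: f_def)
  have monic_f: "lead_coeff f = 1" by (simp add: f_def)
  have poly_f: "poly f 0 = 1" by (simp add: f_def)
  have disc: "discriminant f = b\<^sup>2 - 4" by (simp add: f_def discriminant_quadratic)
  obtain F where comp: "composite n" and n: "n > 1" "odd n"
    and adm: "gcd n (poly f 0 * discriminant f) = 1"
    and fact: "factorization_step n f F" and frob: "frobenius_step n f F"
    and jac: "jacobi_step n f F" and sqr: "square_root_step n f F"
    using assms(4) unfolding b_def[symmetric] f_def[symmetric] strong_frobenius_pseudoprime_def
      strong_frobenius_probable_prime_def frobenius_admissible_def frobenius_steps_def by metis
  have unit: "coprime (b\<^sup>2 - 4) n"
    using adm by (simp add: disc poly_f coprime_iff_gcd_eq_1 gcd.commute)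
  \<comment> \<open>Shows that \<open>P * Q'\<close> divides the discriminant and is thus coprime to
    \<open>n\<close>, so the square in the next congruence leaves the Jacobi symbol
    unchanged.\<close>
  have fac: "b\<^sup>2 - 4 = (P * Q') * (P * (P\<^sup>2 * Q' - 4))"
    by (simp add: b_def power2_eq_square algebra_simps)
  have "[b\<^sup>2 - 4 = (P * Q')\<^sup>2 * \<Delta>] (mod n)"
  proof -
    have "b\<^sup>2 - 4 - (P * Q')\<^sup>2 * \<Delta> = 4 * P\<^sup>2 * Q' * (Q' * Q - 1)"
      by (simp add: b_def assms(1) power2_eq_square algebra_simps)
    then show ?thesis
      using assms(3) by (simp add: cong_iff_dvd_diff)
  qed
  then have jacobi_eq: "jacobi (discriminant f) n = jacobi \<Delta> n"
    unfolding disc by (rule jacobi_square_mult_cong[rotated]) (use unit fac in simp)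
  have "coprime n (2 * \<Delta> * Q)" using assms(2) by (simp only: coprime_iff_gcd_eq_1)
  then have cop\<Delta>: "coprime n (P\<^sup>2 - 4 * Q)"
    by (simp only: coprime_mult_right_iff assms(1))
  have gcdn: "gcd n (2 * Q * \<Delta>) = 1" using assms(2) by (simp only: mult_ac)
  obtain fs where f0: "fs 0 = reduce_poly n f" and f2: "fs 2 = \<one>\<^bsub>UP ?R\<^esub>"
    and step: "\<And>i. i \<in> {1..2} \<Longrightarrow>
           is_gcmd ?R (X_pow ?R (nat n ^ i) \<ominus>\<^bsub>UP ?R\<^esub> X_pow ?R 1) (fs (i - 1)) (F i) \<and>
           fs i \<in> carrier (UP ?R) \<and> fs (i - 1) = F i \<otimes>\<^bsub>UP ?R\<^esub> fs i"
    using fact unfolding factorization_step_def Let_def deg_f by metis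
  have monic: "monic_UP ?R (F 1)" "monic_UP ?R (F 2)"
    using step[of 1] step[of 2] by (auto simp: is_gcmd_def)
  obtain F1 where F1: "F 1 = reduce_poly n F1" "lead_coeff F1 = 1"
    using monic_UP_lift[OF n(1) monic(1)] by metis
  obtain F2 where F2: "F 2 = reduce_poly n F2" "lead_coeff F2 = 1"
    using monic_UP_lift[OF n(1) monic(2)] by metis
  have "fs 1 = reduce_poly n (F2 * 1)"
    unfolding reduce_poly_mult[OF n(1)] using step[of 2] f2 F2 by (simp add: reduce_poly_1[OF n(1)])
  then have f_eq: "reduce_poly n f = reduce_poly n (F1 * F2)"
    using step[of 1] f0 F1 by (simp add: reduce_poly_mult[OF n(1)])
  have F12: "degree F1 + degree F2 = 2"
  proof -
    have "degree (F1 * F2) = degree F1 + degree F2"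
      by (rule degree_mult_eq) (use F1 F2 in auto)
    moreover have "degree f = degree (F1 * F2)"
      using f_eq n(1) F1 F2 reduce_poly_eq_iff[OF n(1)]
      by (intro degree_eq_if_const_dvd_diff[of n]) (simp_all add: lead_coeff_mult f_def)
    ultimately show ?thesis using deg_f by simp
  qed
  obtain S where S: "of_nat S = (of_nat (degree F2) / 2 :: rat)" and eps: "(-1) ^ S = jacobi \<Delta> n"
  proof -
    have "{i. i \<in> {1..degree f} \<and> even i} = {2}" by (auto simp: deg_f elim: evenE)
    then show ?thesis
      using jac that unfolding jacobi_step_def jacobi_eq
      by (auto simp: F2 deg_reduce_poly_monic[OF n(1)])
  qed
  \<comment> \<open>Integrality of \<open>S\<close> makes the degree of \<open>F2\<close> even.
    Being at most 2, it is 0 or 2, so either \<open>F2\<close> or \<open>F1\<close> is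
    trivial.\<close>
  have "(of_nat (degree F2) :: rat) = of_nat (2 * S)" using S by simp
  then have dS: "degree F2 = 2 * S" by (simp only: of_nat_eq_iff)
  have "\<exists>r s. odd s \<and> n = 2 ^ r * int s + jacobi \<Delta> n \<and>
     (?C ([:0, 1:] ^ s) 1 \<or> (\<exists>t<r. ?C ([:0, 1:] ^ (2 ^ t * s)) (-1)))"
  proof (cases "S = 0")
    case True
    \<comment> \<open>The Jacobi symbol is 1 here, and the exponents come from
      \<open>n - 1\<close>.\<close>
    then have "F2 = 1" using dS F2(2) by (metis degree_0_id mult_0_right one_pCons)
    then have "F 1 = reduce_poly n [:1, b, 1:]" using f_eq F1 by (simp add: f_def)
    then obtain r s where "odd s" "nat n ^ 1 - 1 = 2 ^ r * s"
        "?C ([:0, 1:] ^ s) 1 \<or> (\<exists>t<r. ?C ([:0, 1:] ^ (2 ^ t * s)) (-1))"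
      using square_root_step_cong[OF sqr _ _ n(1) unit, of 1] by (metis deg_f atLeastAtMost_iff one_le_numeral order_refl)
    moreover have "n = 2 ^ r * int s + jacobi \<Delta> n"
    proof -
      have "n - 1 = int (nat n ^ 1 - 1)" using n by (simp add: of_nat_diff)
      also have "\<dots> = 2 ^ r * int s" using \<open>nat n ^ 1 - 1 = 2 ^ r * s\<close> by simp
      finally show ?thesis using True eps by simp
    qed
    ultimately show ?thesis by blast
  next
    case False
    then have S1: "S = 1" and "degree F1 = 0" using dS F12 by auto
    then have F1_1: "F1 = 1" using F1(2) by (metis degree_0_id one_pCons)
    then have F2_f: "F 2 = reduce_poly n f" using f_eq F2 by simp
    let ?g = "[:0, 1:] ^ nat n - [:0, 1:] :: int poly"
    have X1: "reduce_poly n [:0, 1:] = X_pow ?R 1"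
      using reduce_poly_X_power[OF n(1), of 1] by (simp only: power_one_right)
    have "is_gcmd ?R (reduce_poly n ?g) (reduce_poly n f) (F 1)"
      using step[of 1, THEN conjunct1] f0 X1
      by (simp add: reduce_poly_diff[OF n(1)] reduce_poly_X_power[OF n(1)])
    then obtain h u where h: "F 1 = reduce_poly n h" "ideal_cong [:n:] f h (?g * u)"
      using is_gcmd_lift[OF n(1)] by metis
    \<comment> \<open>\<open>h\<close> and 1 both lift the trivial gcmd \<open>F 1\<close>, so the
      Bezout relation makes \<open>u\<close> an inverse of \<open>X^n - X\<close> modulo
      \<open>(n, f)\<close>.\<close>
    have "[:n:] dvd 1 - h" using h(1) F1(1) F1_1 reduce_poly_eq_iff[OF n(1)] by metis
    then obtain w where "1 - h = [:n:] * w" by blast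
    then have "ideal_cong [:n:] f 1 h" by (intro ideal_congI[of _ _ _ w _ 0]) simp
    then have 1: "ideal_cong [:n:] f 1 (?g * u)" using h(2) ideal_cong_trans by blast
    have "reduce_poly n f divides\<^bsub>UP ?R\<^esub> reduce_poly n (pcompose f ([:0, 1:] ^ nat n))"
      using frob F2_f subst_X_pow_reduce_poly[OF n(1) monic_f, of "nat n"]
      unfolding frobenius_step_def Let_def deg_f by auto
    then obtain x where "x \<in> carrier (UP ?R)"
        "reduce_poly n (pcompose f ([:0, 1:] ^ nat n)) = reduce_poly n f \<otimes>\<^bsub>UP ?R\<^esub> x"
      unfolding factor_def by blast
    moreover from this obtain v where v: "x = reduce_poly n v" using reduce_poly_surj[OF n(1)] by metis
    ultimately have 2: "ideal_cong [:n:] f (pcompose f ([:0, 1:] ^ nat n)) 0"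
      by (intro reduce_poly_factor[OF n(1)]) (simp_all add: v mult.commute flip: reduce_poly_mult[OF n(1)])
    have conj: "?C ([:0, 1:] ^ Suc (nat n)) 1"
      using frobenius_conjugate[OF 1[unfolded f_def] 2[unfolded f_def]] .
    obtain r s where "odd s" "nat n ^ 2 - 1 = 2 ^ r * s"
        "?C ([:0, 1:] ^ s) 1 \<or> (\<exists>t<r. ?C ([:0, 1:] ^ (2 ^ t * s)) (-1))"
      using square_root_step_cong[OF sqr _ F2_f[unfolded f_def] n(1) unit]
      by (metis deg_f atLeastAtMost_iff one_le_numeral order_refl)
    from conjugate_case_power_cong[OF n conj this]
    obtain r' s' where "odd s'" "Suc (nat n) = 2 ^ r' * s'"
      "?C ([:0, 1:] ^ s') 1 \<or> (\<exists>t<r'. ?C ([:0, 1:] ^ (2 ^ t * s')) (-1))" by metis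
    moreover have "n = 2 ^ r' * int s' + jacobi \<Delta> n"
    proof -
      have "n + 1 = int (Suc (nat n))" using n by simp
      also have "\<dots> = 2 ^ r' * int s'" using \<open>Suc (nat n) = 2 ^ r' * s'\<close> by simp
      finally show ?thesis using S1 eps by simp
    qed
    ultimately show ?thesis by blast
  qed
  then obtain r s where rs: "odd s" "n = 2 ^ r * int s + jacobi \<Delta> n"
    and alt: "?C ([:0, 1:] ^ s) 1 \<or> (\<exists>t<r. ?C ([:0, 1:] ^ (2 ^ t * s)) (-1))" by blast
  have "[lucas_U P Q s = 0] (mod n) \<or> (\<exists>t<r. [lucas_V P Q (2 ^ t * s) = 0] (mod n))"
    using alt lucas_U_cong_0[OF assms(3) cop\<Delta>] lucas_V_cong_0[OF assms(3), of P]
    unfolding b_def by blast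
  with rs comp gcdn show ?thesis
    unfolding strong_lucas_pseudoprime_def Let_def assms(1)[symmetric] by blast
qed

end
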